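(* Suppose there exists a $Q_B$-set $X\subseteq 2^\omega$ of cardinality $\lambda$, where $\mathrm{cf}(\lambda)>\omega$. Then the following are equivalent: (1) there exists a cardinality-preserving nontrivial automorphism of $\mathcal{P}(\lambda)/\mathrm{Ctble}$; (2) there exists a $Q_B$-set $Y\subseteq 2^\omega$ such that $X\triangle Y$ is uncountable and, for every Borel $B\subseteq 2^\omega$, $|B\cap X|+\aleph_0=|B\cap Y|+\aleph_0$.
   Context: A set $X\subseteq 2^\omega$ is a $Q_B$-set if for every $Y\subseteq X$ there is a Borel $B\subseteq 2^\omega$ with $B\cap X=Y$. $\mathrm{Ctble}$ is the ideal of countable subsets of $\lambda$. An automorphism $\pi$ is cardinality-preserving if for every $A\subseteq\lambda$ there is $B$ with $|B|=|A|$ and $\pi([A])=[B]$; it is trivial if there is $f:\lambda\to\lambda$ with $\pi([A])=[f^{-1}(A)]$ for all $A\subseteq\lambda$. *)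

theory Defs
  imports "HOL-Analysis.Analysis"
begin

unbundle cardinal_syntax

definition QB_set :: "(nat \<Rightarrow> bool) set \<Rightarrow> bool" where
  "QB_set X \<longleftrightarrow> (\<forall>Y\<subseteq>X. \<exists>B\<in>sets borel. B \<inter> X = Y)"

text \<open>
  The library's \<open>cofinal\<close> is strict, so no subset of a successor ordinal satisfies it; the
  non-strict version below makes the whole field cofinal in every well-order.
\<close>
definition cofinal_in :: "'a set \<Rightarrow> 'a rel \<Rightarrow> bool" where
  "cofinal_in A r \<longleftrightarrow> A \<subseteq> Field r \<and> (\<forall>a\<in>Field r. \<exists>b\<in>A. (a, b) \<in> r)"

definition cofinality :: "'a rel \<Rightarrow> 'a rel" where
  "cofinality r = |SOME A. cofinal_in A r \<and> (\<forall>B. cofinal_in B r \<longrightarrow> |A| \<le>o |B| )|"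

lemma cofinality_witness:
  fixes r :: "'a rel"
  assumes "Card_order r"
  shows "\<exists>A. cofinal_in A r \<and> cofinality r = |A| \<and> (\<forall>B. cofinal_in B r \<longrightarrow> |A| \<le>o |B| )"
proof -
  define R where "R = {|A| |A. cofinal_in A r}"
  have wo: "Well_order r"
    using assms by (simp add: card_order_on_def)
  then have "refl_on (Field r) r"
    by (simp add: order_on_defs)
  then have "cofinal_in (Field r) r"
    by (auto simp: cofinal_in_def refl_on_def)
  then have "R \<noteq> {}"
    by (auto simp: R_def)
  moreover have "\<forall>p\<in>R. Card_order p"
    by (auto simp: R_def card_of_Card_order)
  ultimately obtain p where "p \<in> R" "\<forall>q\<in>R. p \<le>o q"
    using exists_minim_Card_order by blast
  then have ex: "\<exists>A. cofinal_in A r \<and> (\<forall>B. cofinal_in B r \<longrightarrow> |A| \<le>o |B| )"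
    by (auto simp: R_def)
  show ?thesis
    using someI_ex[OF ex] unfolding cofinality_def by blast
qed

definition Ctble :: "'a set \<Rightarrow> 'a set set" where
  "Ctble L = {A. A \<subseteq> L \<and> countable A}"

definition eq_mod_Ctble :: "'a set \<Rightarrow> 'a set rel" where
  "eq_mod_Ctble L = {(A, B). A \<subseteq> L \<and> B \<subseteq> L \<and> sym_diff A B \<in> Ctble L}"

definition cls :: "'a set \<Rightarrow> 'a set \<Rightarrow> 'a set set" where
  "cls L A = eq_mod_Ctble L `` {A}"

definition Pow_mod_Ctble :: "'a set \<Rightarrow> 'a set set set" where
  "Pow_mod_Ctble L = Pow L // eq_mod_Ctble L"

text \<open>
  The Boolean operations of the quotient, lifted through all representatives; the unions are over
  identical sets by the congruence lemmas below.
\<close>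
definition join_Ctble :: "'a set \<Rightarrow> 'a set set \<Rightarrow> 'a set set \<Rightarrow> 'a set set" where
  "join_Ctble L x y = (\<Union>A\<in>x. \<Union>B\<in>y. cls L (A \<union> B))"

definition meet_Ctble :: "'a set \<Rightarrow> 'a set set \<Rightarrow> 'a set set \<Rightarrow> 'a set set" where
  "meet_Ctble L x y = (\<Union>A\<in>x. \<Union>B\<in>y. cls L (A \<inter> B))"

definition compl_Ctble :: "'a set \<Rightarrow> 'a set set \<Rightarrow> 'a set set" where
  "compl_Ctble L x = (\<Union>A\<in>x. cls L (L - A))"

lemma in_eq_mod_Ctble_iff:
  "(A, B) \<in> eq_mod_Ctble L \<longleftrightarrow> A \<subseteq> L \<and> B \<subseteq> L \<and> countable (sym_diff A B)"
  by (auto simp: eq_mod_Ctble_def Ctble_def)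

lemma equiv_eq_mod_Ctble: "equiv (Pow L) (eq_mod_Ctble L)"
proof (rule equivI)
  show "eq_mod_Ctble L \<subseteq> Pow L \<times> Pow L"
    by (auto simp: in_eq_mod_Ctble_iff)
  show "refl_on (Pow L) (eq_mod_Ctble L)"
    by (auto simp: refl_on_def in_eq_mod_Ctble_iff)
  show "sym (eq_mod_Ctble L)"
    by (auto simp: sym_def in_eq_mod_Ctble_iff)
  show "trans (eq_mod_Ctble L)"
  proof (rule transI)
    fix A B C assume *: "(A, B) \<in> eq_mod_Ctble L" "(B, C) \<in> eq_mod_Ctble L"
    have "sym_diff A C \<subseteq> sym_diff A B \<union> sym_diff B C" by blast
    moreover have "countable (sym_diff A B \<union> sym_diff B C)"
      using * by (simp add: in_eq_mod_Ctble_iff)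
    ultimately show "(A, C) \<in> eq_mod_Ctble L"
      using * by (meson countable_subset in_eq_mod_Ctble_iff)
  qed
qed

lemma cls_eq_iff:
  assumes "A \<subseteq> L" "B \<subseteq> L"
  shows "cls L A = cls L B \<longleftrightarrow> countable (sym_diff A B)"
  using eq_equiv_class_iff[OF equiv_eq_mod_Ctble[of L], of A B] assms
  by (simp add: cls_def in_eq_mod_Ctble_iff)

lemma join_Ctble_cls:
  assumes "A \<subseteq> L" "B \<subseteq> L"
  shows "join_Ctble L (cls L A) (cls L B) = cls L (A \<union> B)"
proof -
  have "cls L (A' \<union> B') = cls L (A \<union> B)" if "A' \<in> cls L A" "B' \<in> cls L B" for A' B'
  proof -
    have "sym_diff (A' \<union> B') (A \<union> B) \<subseteq> sym_diff A A' \<union> sym_diff B B'" by blast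
    moreover have "countable (sym_diff A A' \<union> sym_diff B B')"
      using that by (simp add: cls_def in_eq_mod_Ctble_iff)
    ultimately have "countable (sym_diff (A' \<union> B') (A \<union> B))"
      by (rule countable_subset)
    moreover have "A' \<subseteq> L" "B' \<subseteq> L"
      using that by (simp_all add: cls_def in_eq_mod_Ctble_iff)
    ultimately show ?thesis
      using assms by (subst cls_eq_iff) auto
  qed
  moreover have "A \<in> cls L A" "B \<in> cls L B"
    using assms by (simp_all add: cls_def in_eq_mod_Ctble_iff)
  ultimately show ?thesis unfolding join_Ctble_def by blast
qed

lemma meet_Ctble_cls:
  assumes "A \<subseteq> L" "B \<subseteq> L"
  shows "meet_Ctble L (cls L A) (cls L B) = cls L (A \<inter> B)"
proof -
  have "cls L (A' \<inter> B') = cls L (A \<inter> B)" if "A' \<in> cls L A" "B' \<in> cls L B" for A' B'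
  proof -
    have "sym_diff (A' \<inter> B') (A \<inter> B) \<subseteq> sym_diff A A' \<union> sym_diff B B'" by blast
    moreover have "countable (sym_diff A A' \<union> sym_diff B B')"
      using that by (simp add: cls_def in_eq_mod_Ctble_iff)
    ultimately have "countable (sym_diff (A' \<inter> B') (A \<inter> B))"
      by (rule countable_subset)
    moreover have "A' \<subseteq> L" "B' \<subseteq> L"
      using that by (simp_all add: cls_def in_eq_mod_Ctble_iff)
    ultimately show ?thesis
      using assms by (subst cls_eq_iff) auto
  qed
  moreover have "A \<in> cls L A" "B \<in> cls L B"
    using assms by (simp_all add: cls_def in_eq_mod_Ctble_iff)
  ultimately show ?thesis unfolding meet_Ctble_def by blast
qed

lemma compl_Ctble_cls:
  assumes "A \<subseteq> L"
  shows "compl_Ctble L (cls L A) = cls L (L - A)"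
proof -
  have "cls L (L - A') = cls L (L - A)" if "A' \<in> cls L A" for A'
  proof -
    have "sym_diff (L - A') (L - A) \<subseteq> sym_diff A A'" by blast
    moreover have "countable (sym_diff A A')"
      using that by (simp add: cls_def in_eq_mod_Ctble_iff)
    ultimately have "countable (sym_diff (L - A') (L - A))"
      by (rule countable_subset)
    then show ?thesis
      by (subst cls_eq_iff) auto
  qed
  moreover have "A \<in> cls L A"
    using assms by (simp add: cls_def in_eq_mod_Ctble_iff)
  ultimately show ?thesis unfolding compl_Ctble_def by blast
qed

definition automorphism :: "'a set \<Rightarrow> ('a set set \<Rightarrow> 'a set set) \<Rightarrow> bool" where
  "automorphism L \<pi> \<longleftrightarrow>
     bij_betw \<pi> (Pow_mod_Ctble L) (Pow_mod_Ctble L) \<and>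
     \<pi> (cls L {}) = cls L {} \<and> \<pi> (cls L L) = cls L L \<and>
     (\<forall>x\<in>Pow_mod_Ctble L. \<forall>y\<in>Pow_mod_Ctble L.
        \<pi> (join_Ctble L x y) = join_Ctble L (\<pi> x) (\<pi> y) \<and>
        \<pi> (meet_Ctble L x y) = meet_Ctble L (\<pi> x) (\<pi> y)) \<and>
     (\<forall>x\<in>Pow_mod_Ctble L. \<pi> (compl_Ctble L x) = compl_Ctble L (\<pi> x))"

definition cardinality_preserving :: "'a set \<Rightarrow> ('a set set \<Rightarrow> 'a set set) \<Rightarrow> bool" where
  "cardinality_preserving L \<pi> \<longleftrightarrow>
     (\<forall>A\<subseteq>L. \<exists>B\<subseteq>L. |B| =o |A| \<and> \<pi> (cls L A) = cls L B)"

definition trivial_automorphism :: "'a set \<Rightarrow> ('a set set \<Rightarrow> 'a set set) \<Rightarrow> bool" where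
  "trivial_automorphism L \<pi> \<longleftrightarrow>
     (\<exists>f\<in>L \<rightarrow> L. \<forall>A\<subseteq>L. \<pi> (cls L A) = cls L (f -` A \<inter> L))"

end

theory Submission
  imports Defs "HOL-Library.Countable_Set_Type"
begin

text \<open>
  Fix a bijection \<open>e : \<lambda> \<rightarrow> X\<close>. Since \<open>X\<close> is a \<open>Q\<^sub>B\<close>-set, every subset of \<open>\<lambda>\<close> has the form
  \<open>e\<^sup>-\<^sup>1 B\<close> with \<open>B\<close> Borel. An automorphism \<open>\<pi>\<close> preserves countable joins, hence is determined by
  its values on the preimages of the subbasic clopen sets; collecting these values into one map
  \<open>h : \<lambda> \<rightarrow> 2\<^sup>\<omega>\<close> yields \<open>\<pi>[e\<^sup>-\<^sup>1 B] = [h\<^sup>-\<^sup>1 B]\<close> for every Borel \<open>B\<close>, and \<open>Y\<close> is the range of \<open>h\<close>.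
  Conversely, for a bijection \<open>h : \<lambda> \<rightarrow> Y\<close> this formula defines an automorphism. In both cases \<open>\<pi>\<close>
  is trivial iff \<open>h\<close> maps all but countably many points into \<open>X\<close>: if \<open>f\<close> induces \<open>\<pi>\<close>, then testing
  on clopen sets shows that \<open>e \<circ> f\<close> agrees with \<open>h\<close> off a countable set.
\<close>

section \<open>Equinumerosity up to countable sets\<close>

definition eqpoll_mod_countable :: "'a set \<Rightarrow> 'b set \<Rightarrow> bool"  (infix "\<approx>\<^sub>\<omega>" 50) where
  "A \<approx>\<^sub>\<omega> B \<longleftrightarrow> countable A \<and> countable B \<or> |A| =o |B|"

lemma countable_ordIso_iff: "|A| =o |B| \<Longrightarrow> countable A \<longleftrightarrow> countable B"
  by (meson countable_ordLeq ordIso_iff_ordLeq)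

lemma bij_betw_imp_eqpoll_mod_countable: "bij_betw f A B \<Longrightarrow> A \<approx>\<^sub>\<omega> B"
  by (simp add: eqpoll_mod_countable_def card_of_ordIsoI)

lemma eqpoll_mod_countable_sym: "A \<approx>\<^sub>\<omega> B \<Longrightarrow> B \<approx>\<^sub>\<omega> A"
  by (auto simp: eqpoll_mod_countable_def ordIso_symmetric)

lemma eqpoll_mod_countable_trans [trans]: "A \<approx>\<^sub>\<omega> B \<Longrightarrow> B \<approx>\<^sub>\<omega> C \<Longrightarrow> A \<approx>\<^sub>\<omega> C"
  unfolding eqpoll_mod_countable_def by (meson countable_ordIso_iff ordIso_transitive)

lemma eqpoll_mod_countable_countable_iff: "A \<approx>\<^sub>\<omega> B \<Longrightarrow> countable A \<longleftrightarrow> countable B"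
  by (auto simp: eqpoll_mod_countable_def countable_ordIso_iff)

lemma countable_iff_csum_natLeq: "countable A \<longleftrightarrow> |A| +c natLeq =o natLeq"
proof
  assume "countable A"
  then show "|A| +c natLeq =o natLeq"
    by (simp add: countable_card_le_natLeq csum_absorb2 natLeq_cinfinite natLeq_Card_order)
next
  assume "|A| +c natLeq =o natLeq"
  then have "|A| \<le>o natLeq"
    using ordLeq_csum1[OF card_of_Card_order] by (rule ordLeq_ordIso_trans[rotated])
  then show "countable A"
    by (simp add: countable_card_le_natLeq)
qed

lemma countable_ordLeq_uncountable:
  assumes "countable A" "uncountable B"
  shows "|A| \<le>o |B|"
  using assms countable_ordLeq ordLeq_total[OF card_of_Well_order card_of_Well_order] by blast

lemma uncountable_csum_natLeq:
  assumes "uncountable A"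
  shows "|A| +c natLeq =o |A|"
proof -
  have "natLeq <o |A|"
    using assms by (simp add: countable_card_le_natLeq not_ordLeq_iff_ordLess card_of_Well_order
        natLeq_Well_order)
  then show ?thesis
    by (meson card_of_Card_order cinfinite_mono csum_absorb1 natLeq_cinfinite ordLess_imp_ordLeq)
qed

lemma csum_natLeq_ordIso_iff: "|A| +c natLeq =o |B| +c natLeq \<longleftrightarrow> A \<approx>\<^sub>\<omega> B"
proof
  assume "A \<approx>\<^sub>\<omega> B"
  then consider (countable) "countable A" "countable B" | (ordIso) "|A| =o |B|"
    by (auto simp: eqpoll_mod_countable_def)
  then show "|A| +c natLeq =o |B| +c natLeq"
  proof cases
    case countable
    then show ?thesis
      unfolding countable_iff_csum_natLeq by (meson ordIso_symmetric ordIso_transitive)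
  qed (rule csum_cong1)
next
  assume eq: "|A| +c natLeq =o |B| +c natLeq"
  then have "countable A \<longleftrightarrow> countable B"
    unfolding countable_iff_csum_natLeq by (meson ordIso_symmetric ordIso_transitive)
  moreover have "|A| =o |B|" if "uncountable A" "uncountable B"
    using eq that[THEN uncountable_csum_natLeq] by (meson ordIso_symmetric ordIso_transitive)
  ultimately show "A \<approx>\<^sub>\<omega> B"
    by (auto simp: eqpoll_mod_countable_def)
qed

lemma eqpoll_mod_countable_Diff:
  assumes "countable N"
  shows "A \<approx>\<^sub>\<omega> A - N"
proof (cases "countable A")
  case False
  then have "uncountable (A - N)"
    using assms by (metis uncountable_minus_countable)
  then have "infinite (A - N)" "|N| \<le>o |A - N|"
    using countable_finite countable_ordLeq_uncountable[OF assms] by blast+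
  then have "|(A - N) \<union> N| \<le>o |A - N|"
    by (intro card_of_Un_ordLeq_infinite_Field)
      (simp_all add: Field_card_of card_of_refl ordIso_imp_ordLeq card_of_card_order_on)
  then have "|A| \<le>o |A - N|"
    by (rule ordLeq_transitive[OF card_of_mono1, rotated]) blast
  then show ?thesis
    by (simp add: eqpoll_mod_countable_def ordIso_iff_ordLeq card_of_mono1)
qed (simp add: eqpoll_mod_countable_def)

lemma eqpoll_mod_countable_of_countable_sym_diff:
  assumes "countable (sym_diff A B)"
  shows "A \<approx>\<^sub>\<omega> B"
proof -
  have "A \<approx>\<^sub>\<omega> A - (A - B)"
    using assms by (intro eqpoll_mod_countable_Diff) simp
  also have "A - (A - B) = B - (B - A)"
    by blast
  also have "B - (B - A) \<approx>\<^sub>\<omega> B"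
    using assms by (intro eqpoll_mod_countable_sym[OF eqpoll_mod_countable_Diff]) simp
  finally show ?thesis .
qed

lemma countable_to_one_image_eqpoll_mod_countable:
  assumes fibres: "\<And>p. countable (h -` {p} \<inter> S)"
  shows "S \<approx>\<^sub>\<omega> h ` S"
proof -
  have S: "S = (\<Union>p\<in>h ` S. h -` {p} \<inter> S)"
    by auto
  show ?thesis
  proof (cases "countable (h ` S)")
    case True
    then have "countable S"
      using fibres by (subst S) (rule countable_UN)
    with True show ?thesis
      by (simp add: eqpoll_mod_countable_def)
  next
    case False
    then have "|\<Union>p\<in>h ` S. h -` {p} \<inter> S| \<le>o |h ` S|"
      using countable_finite fibres
      by (intro card_of_UNION_ordLeq_infinite)
        (auto intro: card_of_mono1 countable_ordLeq_uncountable)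
    then show ?thesis
      using S card_of_image[of h S] by (simp add: eqpoll_mod_countable_def ordIso_iff_ordLeq)
  qed
qed

section \<open>Borel subsets of Cantor space\<close>

instance bool :: second_countable_topology
proof
  show "\<exists>B :: bool set set. countable B \<and> open = generate_topology B"
    by (intro exI[of _ "range (\<lambda>a. {..<a}) \<union> range (\<lambda>a. {a<..})"]) (simp add: open_bool_def)
qed

lemma sets_borel_cantor:
  "sets (borel :: ('i::countable \<Rightarrow> bool) measure) = sigma_sets UNIV (range (\<lambda>i. {x. x i}))"
  (is "_ = sigma_sets UNIV ?G")
proof -
  have "sets (borel :: ('i \<Rightarrow> bool) measure) = sets (Pi\<^sub>M UNIV (\<lambda>_. borel :: bool measure))"
    by (simp add: sets_PiM_equal_borel)
  also have "\<dots> = sigma_sets UNIV {{x. x i \<in> A} |i A. True}"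
    by (simp add: sets_PiM_single sets_borel_eq_count_space)
  also have "\<dots> = sigma_sets UNIV ?G"
  proof (rule sigma_sets_eqI)
    fix S assume "S \<in> {{x :: 'i \<Rightarrow> bool. x i \<in> A} |i A. True}"
    then obtain i A where S: "S = {x. x i \<in> A}" by blast
    have coordinate: "{x. x i} \<in> sigma_sets UNIV ?G" by (rule sigma_sets.Basic) blast
    have "S = {} \<or> S = UNIV \<or> S = {x. x i} \<or> S = UNIV - {x. x i}"
      unfolding S by (cases "True \<in> A"; cases "False \<in> A") (auto, (metis (full_types))+)
    then show "S \<in> sigma_sets UNIV ?G"
      using coordinate sigma_sets.Compl[OF coordinate] sigma_sets.Empty sigma_sets_top by metis
  next
    fix S assume "S \<in> ?G"
    then obtain i where "S = {x. x i \<in> {True}}" by auto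
    then show "S \<in> sigma_sets UNIV {{x :: 'i \<Rightarrow> bool. x i \<in> A} |i A. True}"
      by (intro sigma_sets.Basic) blast
  qed
  finally show ?thesis .
qed

lemma coordinate_borel: "{x :: 'i::countable \<Rightarrow> bool. x i} \<in> sets borel"
  unfolding sets_borel_cantor by (rule sigma_sets.Basic) blast

lemma countable_borel_cantor:
  fixes C :: "('i::countable \<Rightarrow> bool) set"
  assumes "countable C"
  shows "C \<in> sets borel"
proof (rule sets.countable[OF _ assms])
  fix a :: "'i \<Rightarrow> bool"
  have "{x. x i = a i} \<in> sets borel" for i
  proof -
    have "{x. x i = a i} = (if a i then {x. x i} else - {x. x i})" by auto
    then show ?thesis using coordinate_borel[of i] by auto
  qed
  then have "(\<Inter>i. {x. x i = a i}) \<in> sets borel" by (intro sets.countable_INT'') auto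
  moreover have "(\<Inter>i. {x. x i = a i}) = {a}" by auto
  ultimately show "{a} \<in> sets borel" by simp
qed

lemma countable_disagreement_of_borel_vimages:
  fixes g h :: "'a \<Rightarrow> 'i::countable \<Rightarrow> bool"
  assumes "\<And>B. B \<in> sets borel \<Longrightarrow> countable (sym_diff (g -` B \<inter> L) (h -` B \<inter> L))"
  shows "countable {l \<in> L. g l \<noteq> h l}"
proof (rule countable_subset)
  show "{l \<in> L. g l \<noteq> h l} \<subseteq> (\<Union>i. sym_diff (g -` {x. x i} \<inter> L) (h -` {x. x i} \<inter> L))"
    by (auto simp: fun_eq_iff)
  show "countable \<dots>"
    using assms[OF coordinate_borel] by blast
qed

section \<open>Automorphisms of the quotient\<close>

lemma Pow_mod_Ctble_eq_image: "Pow_mod_Ctble L = cls L ` Pow L"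
  by (auto simp: Pow_mod_Ctble_def cls_def quotient_def)

lemma cls_Int_eq_iff:
  assumes "A \<subseteq> L" "B \<subseteq> L"
  shows "cls L (A \<inter> B) = cls L A \<longleftrightarrow> countable (A - B)"
proof -
  have "sym_diff (A \<inter> B) A = A - B" by blast
  then show ?thesis using assms by (subst cls_eq_iff) auto
qed

lemma cls_vimage_eq_iff:
  "cls L (k -` B \<inter> L) = cls L (k -` C \<inter> L) \<longleftrightarrow> countable (k -` sym_diff B C \<inter> L)"
proof -
  have "sym_diff (k -` B \<inter> L) (k -` C \<inter> L) = k -` sym_diff B C \<inter> L"
    by (simp only: vimage_Un vimage_Diff) blast
  then show ?thesis
    by (simp only: cls_eq_iff Int_lower2)
qed

lemma automorphism_obtain_image:
  assumes "automorphism L \<pi>" "A \<subseteq> L"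
  obtains C where "C \<subseteq> L" "\<pi> (cls L A) = cls L C"
proof -
  have "\<pi> (cls L A) \<in> Pow_mod_Ctble L"
    using assms by (auto simp: automorphism_def Pow_mod_Ctble_eq_image dest: bij_betwE)
  then show ?thesis
    using that by (auto simp: Pow_mod_Ctble_eq_image)
qed

lemma automorphism_obtain_preimage:
  assumes "automorphism L \<pi>" "C \<subseteq> L"
  obtains A where "A \<subseteq> L" "\<pi> (cls L A) = cls L C"
proof -
  have "cls L C \<in> \<pi> ` Pow_mod_Ctble L"
    using assms by (auto simp: automorphism_def Pow_mod_Ctble_eq_image bij_betw_def)
  then show ?thesis
    using that by (auto simp: Pow_mod_Ctble_eq_image)
qed

lemma automorphism_compl:
  assumes "automorphism L \<pi>" "A \<subseteq> L" "C \<subseteq> L" "\<pi> (cls L A) = cls L C"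
  shows "\<pi> (cls L (L - A)) = cls L (L - C)"
  using assms by (simp add: automorphism_def Pow_mod_Ctble_eq_image flip: compl_Ctble_cls)

lemma automorphism_countable_Diff_iff:
  assumes "automorphism L \<pi>" and subsets: "A \<subseteq> L" "B \<subseteq> L" "C \<subseteq> L" "D \<subseteq> L"
    and images: "\<pi> (cls L A) = cls L C" "\<pi> (cls L B) = cls L D"
  shows "countable (C - D) \<longleftrightarrow> countable (A - B)"
proof -
  have inj: "inj_on \<pi> (Pow_mod_Ctble L)"
    using assms(1) by (simp add: automorphism_def bij_betw_def)
  have "\<pi> (cls L (A \<inter> B)) = cls L (C \<inter> D)"
    using assms by (simp add: automorphism_def Pow_mod_Ctble_eq_image flip: meet_Ctble_cls)
  then have "countable (C - D) \<longleftrightarrow> \<pi> (cls L (A \<inter> B)) = \<pi> (cls L A)"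
    using subsets images by (simp add: cls_Int_eq_iff)
  also have "\<dots> \<longleftrightarrow> cls L (A \<inter> B) = cls L A"
    using subsets by (intro inj_on_eq_iff[OF inj]) (auto simp: Pow_mod_Ctble_eq_image)
  also have "\<dots> \<longleftrightarrow> countable (A - B)"
    using subsets by (simp add: cls_Int_eq_iff)
  finally show ?thesis .
qed

lemma countable_UN_Diff_iff:
  assumes "countable I"
  shows "countable ((\<Union>i\<in>I. A i) - D) \<longleftrightarrow> (\<forall>i\<in>I. countable (A i - D))"
proof -
  have "(\<Union>i\<in>I. A i) - D = (\<Union>i\<in>I. A i - D)" by blast
  then show ?thesis
    using assms by (metis UN_upper countable_UN countable_subset)
qed

text \<open>Isomorphisms preserve suprema, and a countable union is a supremum modulo countable sets.\<close>
lemma automorphism_UN: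
  assumes "automorphism L \<pi>" "countable I"
    and subsets: "\<And>i. i \<in> I \<Longrightarrow> A i \<subseteq> L" "\<And>i. i \<in> I \<Longrightarrow> C i \<subseteq> L"
    and images: "\<And>i. i \<in> I \<Longrightarrow> \<pi> (cls L (A i)) = cls L (C i)"
  shows "\<pi> (cls L (\<Union>i\<in>I. A i)) = cls L (\<Union>i\<in>I. C i)"
proof -
  have UN_subsets: "(\<Union>i\<in>I. A i) \<subseteq> L" "(\<Union>i\<in>I. C i) \<subseteq> L"
    using subsets by auto
  note Diff_iff = automorphism_countable_Diff_iff[OF assms(1)]
  obtain D where D: "D \<subseteq> L" "\<pi> (cls L (\<Union>i\<in>I. A i)) = cls L D"
    using automorphism_obtain_image[OF assms(1) UN_subsets(1)] .
  obtain E where E: "E \<subseteq> L" "\<pi> (cls L E) = cls L (\<Union>i\<in>I. C i)"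
    using automorphism_obtain_preimage[OF assms(1) UN_subsets(2)] .
  have "countable (C i - D)" if "i \<in> I" for i
  proof -
    have "A i - (\<Union>i\<in>I. A i) = {}" using that by blast
    then show ?thesis
      using that Diff_iff[OF _ UN_subsets(1) _ D(1) images D(2)] subsets by (metis countable_empty)
  qed
  then have "countable ((\<Union>i\<in>I. C i) - D)"
    using assms(2) by (simp add: countable_UN_Diff_iff)
  moreover have "countable (A i - E)" if "i \<in> I" for i
  proof -
    have "C i - (\<Union>i\<in>I. C i) = {}" using that by blast
    then show ?thesis
      using that Diff_iff[OF _ E(1) _ UN_subsets(2) images E(2)] subsets by (metis countable_empty)
  qed
  then have "countable ((\<Union>i\<in>I. A i) - E)"
    using assms(2) by (simp add: countable_UN_Diff_iff)
  then have "countable (D - (\<Union>i\<in>I. C i))"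
    using Diff_iff[OF UN_subsets(1) E(1) D(1) UN_subsets(2) D(2) E(2)] by simp
  ultimately have "cls L D = cls L (\<Union>i\<in>I. C i)"
    using D(1) UN_subsets(2) by (simp add: cls_eq_iff)
  with D(2) show ?thesis by simp
qed

lemma automorphism_of_algebra_vimages:
  fixes e g :: "'a \<Rightarrow> 'b"
  assumes "algebra UNIV S"
    and e: "\<And>A. A \<subseteq> L \<Longrightarrow> \<exists>B\<in>S. e -` B \<inter> L = A"
    and g: "\<And>A. A \<subseteq> L \<Longrightarrow> \<exists>B\<in>S. g -` B \<inter> L = A"
    and null: "\<And>B. B \<in> S \<Longrightarrow> countable (e -` B \<inter> L) \<longleftrightarrow> countable (g -` B \<inter> L)"
  shows "\<exists>\<pi>. automorphism L \<pi> \<and> (\<forall>B\<in>S. \<pi> (cls L (e -` B \<inter> L)) = cls L (g -` B \<inter> L))"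
proof -
  interpret algebra UNIV S by fact
  define trace where "trace k B = cls L (k -` B \<inter> L)" for k :: "'a \<Rightarrow> 'b" and B
  have trace_eq_iff: "trace e B = trace e C \<longleftrightarrow> trace g B = trace g C" if "B \<in> S" "C \<in> S" for B C
    using null[of "sym_diff B C"] that by (simp only: trace_def cls_vimage_eq_iff Un Diff)
  then obtain \<pi> where \<pi>: "\<And>B. B \<in> S \<Longrightarrow> \<pi> (trace e B) = trace g B"
    using function_factors_left_gen[of "\<lambda>B. B \<in> S" "trace e" "trace g"] by metis
  have range: "trace e ` S = Pow_mod_Ctble L" "trace g ` S = Pow_mod_Ctble L"
    using e g by (auto simp: trace_def Pow_mod_Ctble_eq_image image_iff) metis+
  have bij: "bij_betw \<pi> (trace e ` S) (trace g ` S)"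
    by (rule bij_betw_imageI) (auto simp: inj_on_def \<pi> trace_eq_iff image_image)
  have join: "join_Ctble L (trace k B) (trace k C) = trace k (B \<union> C)"
    and meet: "meet_Ctble L (trace k B) (trace k C) = trace k (B \<inter> C)"
    and compl: "compl_Ctble L (trace k B) = trace k (UNIV - B)" for k B C
    by (auto simp: trace_def join_Ctble_cls meet_Ctble_cls compl_Ctble_cls
        intro!: arg_cong[of _ _ "cls L"])
  have bounds: "cls L {} = trace k {}" "cls L L = trace k UNIV" for k
    by (simp_all add: trace_def)
  have "automorphism L \<pi>"
    unfolding automorphism_def
  proof (intro conjI ballI)
    show "bij_betw \<pi> (Pow_mod_Ctble L) (Pow_mod_Ctble L)"
      using bij by (simp add: range)
    show "\<pi> (cls L {}) = cls L {}" "\<pi> (cls L L) = cls L L"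
      using \<pi>[of "{}"] \<pi>[of UNIV] by (metis bounds empty_sets top)+
  qed (auto simp: join meet compl \<pi> Un Int compl_sets simp flip: range(1))
  then show ?thesis
    using \<pi> by (auto simp: trace_def)
qed

section \<open>Maps inducing an automorphism on Borel preimages\<close>

definition maps_borel_vimages ::
  "'a set \<Rightarrow> ('a set set \<Rightarrow> 'a set set) \<Rightarrow> ('a \<Rightarrow> 'b::topological_space) \<Rightarrow> ('a \<Rightarrow> 'b) \<Rightarrow> bool" where
  "maps_borel_vimages L \<pi> e h \<longleftrightarrow>
     (\<forall>B\<in>sets borel. \<pi> (cls L (e -` B \<inter> L)) = cls L (h -` B \<inter> L))"

lemma maps_borel_vimagesD:
  "maps_borel_vimages L \<pi> e h \<Longrightarrow> B \<in> sets borel \<Longrightarrow> \<pi> (cls L (e -` B \<inter> L)) = cls L (h -` B \<inter> L)"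
  by (simp add: maps_borel_vimages_def)

lemma automorphism_maps_borel_vimages:
  fixes e :: "'a \<Rightarrow> 'i::countable \<Rightarrow> bool"
  assumes "automorphism L \<pi>"
  obtains h where "maps_borel_vimages L \<pi> e h"
proof -
  have "\<exists>C\<subseteq>L. \<pi> (cls L (e -` {x. x i} \<inter> L)) = cls L C" for i
    using automorphism_obtain_image[OF assms] by (metis inf_le2)
  then obtain C where C: "\<And>i. C i \<subseteq> L" "\<And>i. \<pi> (cls L (e -` {x. x i} \<inter> L)) = cls L (C i)"
    by metis
  define h where "h l i \<longleftrightarrow> l \<in> C i" for l i
  have "\<pi> (cls L (e -` B \<inter> L)) = cls L (h -` B \<inter> L)"
    if "B \<in> sigma_sets UNIV (range (\<lambda>i. {x. x i}))" for B
    using that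
  proof induction
    case (Basic B)
    then obtain i where B: "B = {x. x i}" by blast
    have "h -` {x. x i} \<inter> L = C i"
      using C(1) by (auto simp: h_def)
    then show ?case by (simp only: B C(2))
  next
    case Empty
    show ?case using assms by (simp add: automorphism_def)
  next
    case (Compl B)
    have "k -` (UNIV - B) \<inter> L = L - (k -` B \<inter> L)" for k :: "'a \<Rightarrow> 'i \<Rightarrow> bool"
      by auto
    then show ?case
      using automorphism_compl[OF assms _ _ Compl.IH] by simp
  next
    case (Union B)
    have "k -` (\<Union>i. B i) \<inter> L = (\<Union>i. k -` B i \<inter> L)" for k :: "'a \<Rightarrow> 'i \<Rightarrow> bool"
      by auto
    then show ?case
      using automorphism_UN[OF assms countableI_type _ _ Union.IH] by simp
  qed
  then show ?thesis
    by (intro that[of h]) (simp add: maps_borel_vimages_def sets_borel_cantor)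
qed

lemma QB_set_vimage:
  assumes "QB_set X" "bij_betw e L X" "A \<subseteq> L"
  shows "\<exists>B\<in>sets borel. e -` B \<inter> L = A"
proof -
  have inj: "inj_on e L" and X: "X = e ` L"
    using assms(2) by (auto simp: bij_betw_def)
  have "e ` A \<subseteq> X"
    using assms(3) X by blast
  then obtain B where B: "B \<in> sets borel" "B \<inter> X = e ` A"
    using assms(1) unfolding QB_set_def by blast
  have "e -` B \<inter> L = e -` (B \<inter> X) \<inter> L"
    using X by blast
  also have "\<dots> = A"
    using inj_on_image_mem_iff[OF inj] assms(3) by (auto simp: B(2))
  finally show ?thesis
    using B(1) by blast
qed

lemma bij_betw_vimage_Int: "bij_betw e L X \<Longrightarrow> bij_betw e (e -` B \<inter> L) (B \<inter> X)"
  by (auto simp: bij_betw_def inj_on_def)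

lemma eqpoll_vimage_of_cardinality_preserving:
  assumes "bij_betw e L X" "maps_borel_vimages L \<pi> e h" "cardinality_preserving L \<pi>"
    and "B \<in> sets borel"
  shows "B \<inter> X \<approx>\<^sub>\<omega> h -` B \<inter> L"
proof -
  obtain C where C: "C \<subseteq> L" "|C| =o |e -` B \<inter> L|" "\<pi> (cls L (e -` B \<inter> L)) = cls L C"
    using assms(3) unfolding cardinality_preserving_def by (meson inf_le2)
  have "B \<inter> X \<approx>\<^sub>\<omega> e -` B \<inter> L"
    using bij_betw_vimage_Int[OF assms(1)]
    by (intro eqpoll_mod_countable_sym[OF bij_betw_imp_eqpoll_mod_countable])
  also have "\<dots> \<approx>\<^sub>\<omega> C"
    using C(2) by (simp add: eqpoll_mod_countable_def ordIso_symmetric)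
  also have "C \<approx>\<^sub>\<omega> h -` B \<inter> L"
    using C(1,3) maps_borel_vimagesD[OF assms(2,4)]
    by (intro eqpoll_mod_countable_of_countable_sym_diff) (simp add: cls_eq_iff)
  finally show ?thesis .
qed

lemma cardinality_preserving_of_eqpoll_vimage:
  assumes "QB_set X" "bij_betw e L X" "maps_borel_vimages L \<pi> e h"
    and eqpoll: "\<And>B. B \<in> sets borel \<Longrightarrow> B \<inter> X \<approx>\<^sub>\<omega> h -` B \<inter> L"
  shows "cardinality_preserving L \<pi>"
  unfolding cardinality_preserving_def
proof (intro allI impI)
  fix A assume "A \<subseteq> L"
  then obtain B where B: "B \<in> sets borel" "e -` B \<inter> L = A"
    using QB_set_vimage[OF assms(1,2)] by blast
  have image: "\<pi> (cls L A) = cls L (h -` B \<inter> L)"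
    using maps_borel_vimagesD[OF assms(3) B(1)] B(2) by simp
  have "A \<approx>\<^sub>\<omega> B \<inter> X"
    using bij_betw_vimage_Int[OF assms(2), of B] B(2)
    by (simp add: bij_betw_imp_eqpoll_mod_countable)
  also have "\<dots> \<approx>\<^sub>\<omega> h -` B \<inter> L"
    using B(1) by (rule eqpoll)
  finally consider (countable) "countable A" "countable (h -` B \<inter> L)"
    | (ordIso) "|A| =o |h -` B \<inter> L|"
    by (auto simp: eqpoll_mod_countable_def)
  then show "\<exists>C\<subseteq>L. |C| =o |A| \<and> \<pi> (cls L A) = cls L C"
  proof cases
    case countable
    then have "cls L (h -` B \<inter> L) = cls L A"
      using \<open>A \<subseteq> L\<close> by (simp add: cls_eq_iff)
    with image show ?thesis
      using \<open>A \<subseteq> L\<close> by (intro exI[of _ A]) (simp add: card_of_refl)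
  next
    case ordIso
    with image show ?thesis
      by (intro exI[of _ "h -` B \<inter> L"]) (simp add: ordIso_symmetric)
  qed
qed

lemma trivial_imp_countable_outside:
  fixes e h :: "'a \<Rightarrow> 'i::countable \<Rightarrow> bool"
  assumes "e ` L \<subseteq> X" "maps_borel_vimages L \<pi> e h" "trivial_automorphism L \<pi>"
  shows "countable {l \<in> L. h l \<notin> X}"
proof -
  obtain f where f: "f \<in> L \<rightarrow> L" "\<And>A. A \<subseteq> L \<Longrightarrow> \<pi> (cls L A) = cls L (f -` A \<inter> L)"
    using assms(3) unfolding trivial_automorphism_def by blast
  have "{l \<in> L. h l \<notin> X} \<subseteq> {l \<in> L. h l \<noteq> (e \<circ> f) l}"
    using f(1) assms(1) by auto
  moreover have "countable {l \<in> L. h l \<noteq> (e \<circ> f) l}"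
  proof (rule countable_disagreement_of_borel_vimages)
    fix B :: "('i \<Rightarrow> bool) set" assume "B \<in> sets borel"
    have "f -` (e -` B \<inter> L) \<inter> L = (e \<circ> f) -` B \<inter> L"
      using f(1) by auto
    then have "cls L (h -` B \<inter> L) = cls L ((e \<circ> f) -` B \<inter> L)"
      using maps_borel_vimagesD[OF assms(2) \<open>B \<in> sets borel\<close>] f(2)[of "e -` B \<inter> L"] by simp
    then show "countable (sym_diff (h -` B \<inter> L) ((e \<circ> f) -` B \<inter> L))"
      by (simp add: cls_eq_iff)
  qed
  ultimately show ?thesis
    by (rule countable_subset)
qed

lemma countable_outside_imp_trivial:
  assumes "QB_set X" "bij_betw e L X" "maps_borel_vimages L \<pi> e h" "countable {l \<in> L. h l \<notin> X}"
  shows "trivial_automorphism L \<pi>"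
proof -
  define f where "f l = (if h l \<in> X then inv_into L e (h l) else l)" for l
  have f: "f \<in> L \<rightarrow> L"
    using assms(2) by (auto simp: f_def bij_betw_def inv_into_into)
  have ef: "e (f l) = h l" if "h l \<in> X" for l
    using that assms(2) by (auto simp: f_def bij_betw_def f_inv_into_f)
  have "\<pi> (cls L A) = cls L (f -` A \<inter> L)" if "A \<subseteq> L" for A
  proof -
    obtain B where B: "B \<in> sets borel" "e -` B \<inter> L = A"
      using QB_set_vimage[OF assms(1,2) \<open>A \<subseteq> L\<close>] by blast
    have "sym_diff (h -` B \<inter> L) (f -` A \<inter> L) \<subseteq> {l \<in> L. h l \<notin> X}"
      using B(2) ef f by fastforce
    then have "cls L (h -` B \<inter> L) = cls L (f -` A \<inter> L)"
      using countable_subset[OF _ assms(4)] by (simp add: cls_eq_iff)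
    then show ?thesis
      using maps_borel_vimagesD[OF assms(3) B(1)] B(2) by simp
  qed
  with f show ?thesis
    unfolding trivial_automorphism_def by blast
qed

lemma QB_set_countable_Diff:
  assumes "QB_set X" "countable (Y - X)"
    and "\<And>B. B \<in> sets borel \<Longrightarrow> countable (B \<inter> Y) \<Longrightarrow> countable (B \<inter> X)"
  shows "countable (X - Y)"
proof -
  obtain B where B: "B \<in> sets borel" "B \<inter> X = X - Y"
    using assms(1) unfolding QB_set_def by blast
  then have "B \<inter> Y \<subseteq> Y - X" by blast
  then have "countable (B \<inter> Y)"
    using assms(2) by (rule countable_subset)
  with assms(3) B show ?thesis by metis
qed

lemma trivial_automorphism_iff_countable_sym_diff:
  assumes "QB_set X" "bij_betw e L X" "maps_borel_vimages L \<pi> e h"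
    and fibres: "\<And>C. countable C \<Longrightarrow> countable (h -` C \<inter> L)"
    and eqpoll: "\<And>B. B \<in> sets borel \<Longrightarrow> B \<inter> X \<approx>\<^sub>\<omega> B \<inter> h ` L"
  shows "trivial_automorphism L \<pi> \<longleftrightarrow> countable (sym_diff X (h ` L))"
proof -
  have "e ` L \<subseteq> X"
    using assms(2) by (simp add: bij_betw_def)
  then have "trivial_automorphism L \<pi> \<longleftrightarrow> countable {l \<in> L. h l \<notin> X}"
    by (rule iffI[OF trivial_imp_countable_outside[OF _ assms(3)]
          countable_outside_imp_trivial[OF assms(1-3)]])
  also have "\<dots> \<longleftrightarrow> countable (h ` L - X)"
  proof
    have "h ` {l \<in> L. h l \<notin> X} = h ` L - X" by blast
    then show "countable (h ` L - X)" if "countable {l \<in> L. h l \<notin> X}"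
      using countable_image[OF that, of h] by simp
    have "{l \<in> L. h l \<notin> X} = h -` (h ` L - X) \<inter> L" by blast
    then show "countable {l \<in> L. h l \<notin> X}" if "countable (h ` L - X)"
      using fibres[OF that] by simp
  qed
  also have "\<dots> \<longleftrightarrow> countable (sym_diff X (h ` L))"
    using QB_set_countable_Diff[OF assms(1)] eqpoll_mod_countable_countable_iff[OF eqpoll] by auto
  finally show ?thesis .
qed

lemma QB_set_if_mod_countable:
  assumes "\<And>Z. Z \<subseteq> Y \<Longrightarrow> \<exists>B\<in>sets borel. countable (sym_diff (B \<inter> Y) Z)"
  shows "QB_set Y"
  unfolding QB_set_def
proof (intro allI impI)
  fix Z assume "Z \<subseteq> Y"
  then obtain B where B: "B \<in> sets borel" "countable (sym_diff (B \<inter> Y) Z)"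
    using assms by blast
  show "\<exists>B\<in>sets borel. B \<inter> Y = Z"
  proof
    show "(B - (B \<inter> Y - Z)) \<union> (Z - B \<inter> Y) \<in> sets borel"
      using B(2) by (intro sets.Un sets.Diff[OF B(1)] countable_borel_cantor) auto
    show "((B - (B \<inter> Y - Z)) \<union> (Z - B \<inter> Y)) \<inter> Y = Z"
      using \<open>Z \<subseteq> Y\<close> by blast
  qed
qed

lemma QB_set_image:
  assumes "QB_set X" "bij_betw e L X" "automorphism L \<pi>" "maps_borel_vimages L \<pi> e h"
  shows "QB_set (h ` L)"
proof (rule QB_set_if_mod_countable)
  fix Z assume "Z \<subseteq> h ` L"
  obtain A where A: "A \<subseteq> L" "\<pi> (cls L A) = cls L (h -` Z \<inter> L)"
    using automorphism_obtain_preimage[OF assms(3)] by (metis inf_le2)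
  obtain B where B: "B \<in> sets borel" "e -` B \<inter> L = A"
    using QB_set_vimage[OF assms(1,2) A(1)] by blast
  have "cls L (h -` B \<inter> L) = cls L (h -` Z \<inter> L)"
    using maps_borel_vimagesD[OF assms(4) B(1)] A(2) B(2) by simp
  then have "countable (h ` (h -` sym_diff B Z \<inter> L))"
    by (simp only: cls_vimage_eq_iff countable_image)
  moreover have "sym_diff (B \<inter> h ` L) Z \<subseteq> h ` (h -` sym_diff B Z \<inter> L)"
    using \<open>Z \<subseteq> h ` L\<close> by auto
  ultimately have "countable (sym_diff (B \<inter> h ` L) Z)"
    by (rule countable_subset[rotated])
  with B(1) show "\<exists>B\<in>sets borel. countable (sym_diff (B \<inter> h ` L) Z)" by blast
qed

section \<open>The equivalence\<close>

lemma QB_set_of_nontrivial_automorphism: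
  assumes "QB_set X" "bij_betw e L X"
    and "automorphism L \<pi>" "cardinality_preserving L \<pi>" "\<not> trivial_automorphism L \<pi>"
  shows "\<exists>Y. QB_set Y \<and> uncountable (sym_diff X Y) \<and> (\<forall>B\<in>sets borel. B \<inter> X \<approx>\<^sub>\<omega> B \<inter> Y)"
proof -
  obtain h where h: "maps_borel_vimages L \<pi> e h"
    using automorphism_maps_borel_vimages[OF assms(3)] .
  have eqpoll_vimage: "B \<inter> X \<approx>\<^sub>\<omega> h -` B \<inter> L" if "B \<in> sets borel" for B
    using eqpoll_vimage_of_cardinality_preserving[OF assms(2) h assms(4) that] .
  have fibres: "countable (h -` C \<inter> L)" if "countable C" for C
    using that eqpoll_mod_countable_countable_iff[OF eqpoll_vimage[OF countable_borel_cantor]]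
    by simp
  have eqpoll: "B \<inter> X \<approx>\<^sub>\<omega> B \<inter> h ` L" if "B \<in> sets borel" for B
  proof -
    have "countable (h -` {p} \<inter> (h -` B \<inter> L))" for p
      using fibres[of "{p}"] by (rule countable_subset[rotated]) auto
    then have "h -` B \<inter> L \<approx>\<^sub>\<omega> h ` (h -` B \<inter> L)"
      by (rule countable_to_one_image_eqpoll_mod_countable)
    also have "h ` (h -` B \<inter> L) = B \<inter> h ` L" by auto
    finally show ?thesis
      using eqpoll_vimage[OF that] eqpoll_mod_countable_trans by blast
  qed
  have "uncountable (sym_diff X (h ` L))"
    using trivial_automorphism_iff_countable_sym_diff[OF assms(1,2) h fibres eqpoll] assms(5)
    by blast
  then show ?thesis
    using QB_set_image[OF assms(1,2,3) h] eqpoll by blast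
qed

lemma nontrivial_automorphism_of_QB_set:
  assumes "QB_set X" "bij_betw e L X" "QB_set Y" "uncountable (sym_diff X Y)"
    and eqpoll: "\<And>B. B \<in> sets borel \<Longrightarrow> B \<inter> X \<approx>\<^sub>\<omega> B \<inter> Y"
  shows "\<exists>\<pi>. automorphism L \<pi> \<and> cardinality_preserving L \<pi> \<and> \<not> trivial_automorphism L \<pi>"
proof -
  have "|X| =o |Y|"
    using eqpoll[of UNIV] assms(4) by (auto simp: eqpoll_mod_countable_def)
  then obtain g where g: "bij_betw g L Y"
    using card_of_ordIso bij_betw_trans assms(2) by metis
  have eqpoll_vimage: "B \<inter> X \<approx>\<^sub>\<omega> g -` B \<inter> L" if "B \<in> sets borel" for B
    using eqpoll[OF that] bij_betw_vimage_Int[OF g]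
    by (meson bij_betw_imp_eqpoll_mod_countable eqpoll_mod_countable_sym eqpoll_mod_countable_trans)
  have "countable (e -` B \<inter> L) \<longleftrightarrow> countable (g -` B \<inter> L)" if "B \<in> sets borel" for B
    using bij_betw_vimage_Int[OF assms(2)] eqpoll_vimage[OF that]
    by (meson bij_betw_imp_eqpoll_mod_countable eqpoll_mod_countable_countable_iff)
  moreover have "algebra UNIV (sets (borel :: (nat \<Rightarrow> bool) measure))"
    using sets.algebra_axioms[of borel] by simp
  ultimately obtain \<pi> where \<pi>: "automorphism L \<pi>" "maps_borel_vimages L \<pi> e g"
    using automorphism_of_algebra_vimages[of "sets borel" L e g]
      QB_set_vimage[OF assms(1,2)] QB_set_vimage[OF assms(3) g]
    unfolding maps_borel_vimages_def by blast
  have "cardinality_preserving L \<pi>"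
    using cardinality_preserving_of_eqpoll_vimage[OF assms(1,2) \<pi>(2) eqpoll_vimage] .
  moreover have "\<not> trivial_automorphism L \<pi>"
  proof -
    have range: "g ` L = Y" and inj: "inj_on g L"
      using g by (auto simp: bij_betw_def)
    have "countable (g -` C \<inter> L)" if "countable C" for C
      using countable_image_inj_Int_vimage[OF inj that] by (simp add: Int_commute)
    then show ?thesis
      using trivial_automorphism_iff_countable_sym_diff[OF assms(1,2) \<pi>(2)] range eqpoll assms(4)
      by metis
  qed
  ultimately show ?thesis
    using \<pi>(1) by blast
qed

theorem theorem5p6:
  fixes lam :: "'a rel" and X :: "(nat \<Rightarrow> bool) set"
  assumes "Card_order lam"
    and "natLeq <o cofinality lam"
    and "QB_set X"
    and "|X| =o lam"
  shows
    "(\<exists>\<pi>. automorphism (Field lam) \<pi> \<and> cardinality_preserving (Field lam) \<pi> \<and>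
          \<not> trivial_automorphism (Field lam) \<pi>)
     \<longleftrightarrow>
     (\<exists>Y :: (nat \<Rightarrow> bool) set. QB_set Y \<and> uncountable (sym_diff X Y) \<and>
          (\<forall>B\<in>sets borel. |B \<inter> X| +c natLeq =o |B \<inter> Y| +c natLeq))"
proof -
  have "|Field lam| =o |X|"
    using card_of_Field_ordIso[OF assms(1)] ordIso_symmetric[OF assms(4)]
    by (rule ordIso_transitive)
  then obtain e where e: "bij_betw e (Field lam) X"
    using card_of_ordIso by blast
  show ?thesis
    unfolding csum_natLeq_ordIso_iff
    by (meson QB_set_of_nontrivial_automorphism[OF assms(3) e]
        nontrivial_automorphism_of_QB_set[OF assms(3) e])
qed

end
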